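(* For every integer $r\geqslant 8$, $C(n,K_{r})=\Omega(n^{2/3})$ as $n\to\infty$.
   Context: For a graph $H$ and a positive integer $n$, $C(n,H)$ denotes the minimum integer $k$ such that there exist $n$ colorings $f_v:E(K_n)\to[k]$, one for each vertex $v\in V(K_n)$ (the colorings need not be proper), with the following property: for every copy $T$ of $H$ in $K_n$, there is a vertex $v\in V(T)$ such that $f_v$ assigns pairwise distinct colors to all edges of $E(T)$. $K_r$ is the complete graph on $r$ vertices. *)

theory Defs
  imports "HOL-Library.Landau_Symbols" "HOL-Library.FuncSet"
begin

text \<open>Simple graphs; an undirected edge is a two-element set of vertices.\<close>

datatype 'a graph = Graph (verts: "'a set") (edges: "'a set set")

definition complete_graph :: "nat \<Rightarrow> nat graph" where
  "complete_graph n = Graph {1..n} {e. e \<subseteq> {1..n} \<and> card e = 2}"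

definition subgraph :: "'a graph \<Rightarrow> 'a graph \<Rightarrow> bool" where
  "subgraph T G \<longleftrightarrow> verts T \<subseteq> verts G \<and> edges T \<subseteq> edges G \<and> (\<forall>e\<in>edges T. e \<subseteq> verts T)"

definition graph_isomorphic :: "'a graph \<Rightarrow> 'b graph \<Rightarrow> bool" where
  "graph_isomorphic G H \<longleftrightarrow>
     (\<exists>\<phi>. bij_betw \<phi> (verts G) (verts H) \<and> edges H = (\<lambda>e. \<phi> ` e) ` edges G)"

definition is_copy :: "'a graph \<Rightarrow> 'b graph \<Rightarrow> 'b graph \<Rightarrow> bool" where
  "is_copy H G T \<longleftrightarrow> subgraph T G \<and> graph_isomorphic H T"

definition good_colorings :: "nat \<Rightarrow> 'a graph \<Rightarrow> nat \<Rightarrow> (nat \<Rightarrow> nat set \<Rightarrow> nat) \<Rightarrow> bool" where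
  "good_colorings n H k f \<longleftrightarrow>
     (\<forall>v\<in>verts (complete_graph n). f v \<in> edges (complete_graph n) \<rightarrow> {1..k}) \<and>
     (\<forall>T. is_copy H (complete_graph n) T \<longrightarrow> (\<exists>v\<in>verts T. inj_on (f v) (edges T)))"

definition C :: "nat \<Rightarrow> 'a graph \<Rightarrow> nat" where
  "C n H = (LEAST k. \<exists>f. good_colorings n H k f)"

text \<open>The minimum is attained as soon as \<open>H\<close> has a vertex: colour all edges injectively.\<close>

lemma good_colorings_C:
  assumes "verts H \<noteq> {}"
  shows "\<exists>f. good_colorings n H (C n H) f"
proof -
  let ?E = "edges (complete_graph n)"
  have "finite ?E"
    unfolding complete_graph_def by (rule finite_subset[of _ "Pow {1..n}"]) auto
  then obtain g where g: "bij_betw g ?E {1..card ?E}"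
    using finite_same_card_bij[of ?E "{1..card ?E}"] by auto
  have "\<exists>v\<in>verts T. inj_on g (edges T)" if "is_copy H (complete_graph n) T" for T
  proof -
    have "verts T \<noteq> {}" "edges T \<subseteq> ?E"
      using that assms by (auto simp: is_copy_def graph_isomorphic_def subgraph_def bij_betw_def)
    then show ?thesis
      using g by (meson bij_betw_def ex_in_conv inj_on_subset)
  qed
  then have "good_colorings n H (card ?E) (\<lambda>_. g)"
    using bij_betw_imp_funcset[OF g] by (simp add: good_colorings_def)
  then have "\<exists>k f. good_colorings n H k f"
    by (intro exI)
  then show ?thesis
    unfolding C_def by (rule LeastI_ex)
qed

end

theory Submission imports Defs "HOL-Analysis.Convex" "HOL-Real_Asymp.Real_Asymp" begin

text \<open>
  Fix vertices \<open>y \<noteq> z\<close> and let \<open>D\<close> be the set of all \<open>v\<close> whose own colouring gives \<open>vy\<close> and \<open>vz\<close>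
  the same colour: no vertex of \<open>D\<close> is a witness for a clique that contains \<open>y\<close> and \<open>z\<close>. By double
  counting, some pair has \<open>|D| \<ge> (n - 1) / k - 1\<close>. If \<open>k\<close> is below a small multiple of
  \<open>n powr (2 / 3)\<close>, then \<open>D\<close> spans more than \<open>2 * k\<close> edges, so some edge \<open>e\<close> inside \<open>D\<close> shares its
  colour under \<open>f y\<close> with another edge \<open>e'\<close> and its colour under \<open>f z\<close> with another edge \<open>e''\<close>, both
  inside \<open>D\<close>. The at most eight vertices \<open>{y, z} \<union> e \<union> e' \<union> e''\<close>, padded with vertices of \<open>D\<close>, form
  a clique without a witness.
\<close>

text \<open>Any bijection from \<open>{1..r}\<close> onto \<open>S\<close> makes the complete graph
  on \<open>S\<close> a copy of \<open>complete_graph r\<close>, so later arguments can speak of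
  vertex sets instead of copies.\<close>

lemma good_colorings_complete_graphD:
  assumes good: "good_colorings n (complete_graph r) k f"
    and S: "S \<subseteq> {1..n}" "card S = r"
  obtains v where "v \<in> S" "inj_on (f v) {e. e \<subseteq> S \<and> card e = 2}"
proof -
  define T where "T = Graph S {e. e \<subseteq> S \<and> card e = 2}"
  have finS: "finite S"
    using S(1) finite_subset by blast
  obtain \<phi> where \<phi>: "bij_betw \<phi> {1..r} S"
    using finite_same_card_bij[of "{1..r}" S] finS S(2) by auto
  have "(\<lambda>e. \<phi> ` e) ` {e. e \<subseteq> {1..r} \<and> card e = 2} = {e. e \<subseteq> S \<and> card e = 2}" (is "?L = ?R")
  proof (intro equalityI subsetI)
    fix e assume "e \<in> ?L"
    then show "e \<in> ?R"
      using \<phi> by (auto simp: bij_betw_def card_image inj_on_subset)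
  next
    fix e assume e: "e \<in> ?R"
    then obtain d where d: "d \<subseteq> {1..r}" "e = \<phi> ` d"
      using \<phi> by (auto simp: bij_betw_def subset_image_iff)
    moreover have "card d = 2"
      using e d \<phi> by (metis (mono_tags, lifting) bij_betw_def card_image inj_on_subset mem_Collect_eq)
    ultimately show "e \<in> ?L"
      by auto
  qed
  then have "graph_isomorphic (complete_graph r) T"
    using \<phi> unfolding graph_isomorphic_def complete_graph_def T_def graph.sel
    by (intro exI[of _ \<phi>] conjI) simp_all
  moreover have "subgraph T (complete_graph n)"
    using S(1) by (auto simp: subgraph_def complete_graph_def T_def)
  ultimately have "is_copy (complete_graph r) (complete_graph n) T"
    by (simp add: is_copy_def)
  then show thesis
    using good that by (auto simp: good_colorings_def T_def)
qed

text \<open>Elements alone in their colour class use up one colour each. Every other element of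
  \<open>E\<close> has a partner of its own colour.\<close>

lemma card_uniquely_coloured_le:
  assumes "g \<in> E \<rightarrow> {1..k::nat}"
  shows "card {e \<in> E. \<forall>e'\<in>E. g e' = g e \<longrightarrow> e' = e} \<le> k"
proof -
  have "inj_on g {e \<in> E. \<forall>e'\<in>E. g e' = g e \<longrightarrow> e' = e}"
    by (auto simp: inj_on_def)
  then have "card {e \<in> E. \<forall>e'\<in>E. g e' = g e \<longrightarrow> e' = e} \<le> card {1..k}"
    by (rule card_inj_on_le) (use assms in auto)
  then show ?thesis by simp
qed

text \<open>Cauchy-Schwarz for the sizes of the colour classes: their squares add up to the number
  of ordered monochromatic pairs, with the diagonal contributing the extra
  \<open>card X\<close>.\<close>

lemma card_square_le_monochromatic_pairs:
  assumes "finite X" and g: "g \<in> X \<rightarrow> {1..k::nat}"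
  shows "(card X)\<^sup>2 \<le> k * (card {(y, z). y \<in> X \<and> z \<in> X \<and> y \<noteq> z \<and> g y = g z} + card X)"
proof -
  define A where "A c = {x \<in> X. g x = c}" for c
  have finA: "finite (A c)" for c
    using assms(1) by (simp add: A_def)
  let ?P = "{(y, z). y \<in> X \<and> z \<in> X \<and> y \<noteq> z \<and> g y = g z}"
  have "card X = card (\<Union>c\<in>{1..k}. A c)"
    using g by (intro arg_cong[of _ _ card]) (auto simp: A_def)
  also have "\<dots> = (\<Sum>c=1..k. card (A c))"
    by (rule card_UN_disjoint) (use finA in \<open>auto simp: A_def\<close>)
  finally have X: "card X = (\<Sum>c=1..k. card (A c))" .
  have "?P \<union> (\<lambda>x. (x, x)) ` X = (\<Union>c\<in>{1..k}. A c \<times> A c)"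
    using g by (auto simp: A_def)
  moreover have "card (\<Union>c\<in>{1..k}. A c \<times> A c) = (\<Sum>c=1..k. card (A c \<times> A c))"
    by (rule card_UN_disjoint) (use finA in \<open>auto simp: A_def\<close>)
  moreover have "card (?P \<union> (\<lambda>x. (x, x)) ` X) = card ?P + card X"
  proof (subst card_Un_disjoint)
    show "finite ?P"
      by (rule finite_subset[of _ "X \<times> X"]) (use assms(1) in auto)
  qed (use assms(1) in \<open>auto simp: card_image inj_on_def\<close>)
  ultimately have P: "card ?P + card X = (\<Sum>c=1..k. (card (A c))\<^sup>2)"
    by (simp add: card_cartesian_product power2_eq_square)
  have "(\<Sum>c=1..k. real (card (A c)))\<^sup>2 \<le> k * (\<Sum>c=1..k. (real (card (A c)))\<^sup>2)"
    using Cauchy_Schwarz_ineq_sum[of "\<lambda>_. 1" "\<lambda>c. real (card (A c))" "{1..k}"] by simp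
  then have "real ((\<Sum>c=1..k. card (A c))\<^sup>2) \<le> real (k * (\<Sum>c=1..k. (card (A c))\<^sup>2))"
    by simp
  then show ?thesis
    unfolding P of_nat_le_iff X[symmetric] .
qed

text \<open>Triples \<open>(v, y, z)\<close> in which \<open>f v\<close> repeats a colour on the
  edges from \<open>v\<close> to \<open>y\<close> and \<open>z\<close> are counted in two ways. The
  previous bound, applied to the \<open>n - 1\<close> edges at each \<open>v\<close>, makes them
  numerous; averaging over the ordered pairs \<open>(y, z)\<close> does the rest.\<close>

lemma exists_popular_pair:
  fixes n k :: nat and f :: "nat \<Rightarrow> nat set \<Rightarrow> nat"
  assumes "n \<ge> 2" and col: "\<And>v. v \<in> {1..n} \<Longrightarrow> f v \<in> {e. e \<subseteq> {1..n} \<and> card e = 2} \<rightarrow> {1..k}"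
  obtains y z where "y \<in> {1..n}" "z \<in> {1..n}" "y \<noteq> z"
    "n - 1 \<le> k * (card {v \<in> {1..n} - {y, z}. f v {v, y} = f v {v, z}} + 1)"
proof -
  define D where "D = (\<lambda>(y, z). {v \<in> {1..n} - {y, z}. f v {v, y} = f v {v, z}})"
  define X where "X v = {1..n} - {v}" for v
  define P where
    "P v = {(y, z). y \<in> X v \<and> z \<in> X v \<and> y \<noteq> z \<and> f v {v, y} = f v {v, z}}" for v
  define Q where "Q = {(y, z). y \<in> {1..n} \<and> z \<in> {1..n} \<and> y \<noteq> z}"
  have finQ: "finite Q"
    by (rule finite_subset[of _ "{1..n} \<times> {1..n}"]) (auto simp: Q_def)
  have "Q = (SIGMA y:{1..n}. {1..n} - {y})"
    by (auto simp: Q_def)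
  then have cardQ: "card Q = n * (n - 1)"
    by (simp add: card_SigmaI)
  have P: "(n - 1)\<^sup>2 \<le> k * (card (P v) + (n - 1))" if v: "v \<in> {1..n}" for v
  proof -
    have "(\<lambda>y. f v {v, y}) \<in> X v \<rightarrow> {1..k}"
      using col[OF v] v by (auto simp: X_def card_insert_if Pi_iff)
    from card_square_le_monochromatic_pairs[OF _ this] show ?thesis
      using v by (simp add: X_def P_def)
  qed
  have "(\<Sum>v=1..n. card (P v)) = (\<Sum>v=1..n. card {q \<in> Q. v \<in> D q})"
    by (intro sum.cong refl arg_cong[of _ _ card]) (auto simp: P_def Q_def D_def X_def)
  also have "\<dots> = (\<Sum>q\<in>Q. card {v \<in> {1..n}. v \<in> D q})"
    using sum_multicount_gen[of "{1..n}" Q "\<lambda>v q. v \<in> D q" "\<lambda>q. card {v \<in> {1..n}. v \<in> D q}"] finQ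
    by simp
  also have "\<dots> = (\<Sum>q\<in>Q. card (D q))"
    by (intro sum.cong refl arg_cong[of _ _ card]) (auto simp: D_def)
  finally have PD: "(\<Sum>v=1..n. card (P v)) = (\<Sum>q\<in>Q. card (D q))" .
  \<comment> \<open>The diagonal terms, \<open>n - 1\<close> for each of the \<open>n\<close>
    vertices, total \<open>card Q\<close>, which is exactly the \<open>+ 1\<close> granted to each
    pair.\<close>
  have "\<exists>q\<in>Q. n - 1 \<le> k * (card (D q) + 1)"
  proof (rule ccontr)
    assume "\<not> ?thesis"
    moreover have "Q \<noteq> {}"
      using cardQ assms(1) by auto
    ultimately have "(\<Sum>q\<in>Q. k * (card (D q) + 1)) < (\<Sum>q\<in>Q. n - 1)"
      using finQ by (intro sum_strict_mono) auto
    then have "k * (\<Sum>q\<in>Q. card (D q)) + k * (n * (n - 1)) < n * (n - 1) * (n - 1)"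
      by (simp add: cardQ sum.distrib sum_distrib_left mult_ac)
    moreover have "(\<Sum>v=1..n. (n - 1)\<^sup>2) \<le> (\<Sum>v=1..n. k * (card (P v) + (n - 1)))"
      by (rule sum_mono) (use P in blast)
    then have "n * (n - 1)\<^sup>2 \<le> k * (\<Sum>v=1..n. card (P v)) + n * (k * (n - 1))"
      by (simp only: distrib_left sum.distrib sum_distrib_left sum_constant card_atLeastAtMost) simp
    ultimately show False
      unfolding PD by (simp add: power2_eq_square mult_ac)
  qed
  then show thesis
    using that by (auto simp: Q_def D_def)
qed

text \<open>With more edges in \<open>D\<close>, some edge would have a partner of its colour under
  both \<open>f y\<close> and \<open>f z\<close>. The bound \<open>r \<ge> 8\<close> leaves room for
  \<open>y\<close>, \<open>z\<close> and three edges, and \<open>large\<close> allows padding to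
  exactly \<open>r\<close> vertices.\<close>

lemma good_colorings_popular_pair_bound:
  assumes good: "good_colorings n (complete_graph r) k f" and r: "r \<ge> 8"
    and yz: "y \<in> {1..n}" "z \<in> {1..n}" "y \<noteq> z"
    and D: "D \<subseteq> {1..n} - {y, z}" "\<And>v. v \<in> D \<Longrightarrow> f v {v, y} = f v {v, z}"
    and large: "r - 2 \<le> card D"
  shows "card D choose 2 \<le> 2 * k"
proof (rule ccontr)
  assume many: "\<not> ?thesis"
  define E where "E = {e. e \<subseteq> D \<and> card e = 2}"
  define U where "U x = {e \<in> E. \<forall>e'\<in>E. f x e' = f x e \<longrightarrow> e' = e}" for x
  have finD: "finite D"
    using D(1) finite_subset by blast
  have finE: "finite E"
    unfolding E_def by (rule finite_subset[of _ "Pow D"]) (use finD in auto)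
  have cardE: "card E = card D choose 2"
    unfolding E_def using finD by (rule n_subsets)
  have U: "card (U x) \<le> k" if "x \<in> {1..n}" for x
  proof -
    have "f x \<in> E \<rightarrow> {1..k}"
      using good that D(1) unfolding good_colorings_def complete_graph_def graph.sel E_def by blast
    then show ?thesis
      unfolding U_def by (rule card_uniquely_coloured_le)
  qed
  \<comment> \<open>One edge \<open>e\<close> must serve both \<open>y\<close> and \<open>z\<close>:
    separate monochromatic pairs of edges could cover eight vertices of \<open>D\<close> instead of
    six.\<close>
  have "card (U y \<union> U z) \<le> 2 * k"
    using card_Un_le[of "U y" "U z"] U[OF yz(1)] U[OF yz(2)] by linarith
  then have "\<not> E \<subseteq> U y \<union> U z"
    using many cardE finE card_mono[of "U y \<union> U z" E] by (auto simp: U_def)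
  then obtain e e' e'' where e: "e \<in> E" "e' \<in> E" "e'' \<in> E"
    and ey: "e' \<noteq> e" "f y e' = f y e" and ez: "e'' \<noteq> e" "f z e'' = f z e"
    by (auto simp: U_def)
  have "card (e \<union> e' \<union> e'') \<le> 6"
    using card_Un_le[of "e \<union> e'" e''] card_Un_le[of e e'] e by (simp add: E_def)
  then have "card (e \<union> e' \<union> e'') \<le> r - 2"
    using r by linarith
  moreover have "e \<union> e' \<union> e'' \<subseteq> D"
    using e by (auto simp: E_def)
  ultimately obtain B where B: "e \<union> e' \<union> e'' \<subseteq> B" "B \<subseteq> D" "card B = r - 2"
    using exists_subset_between large finD by metis
  define S where "S = insert y (insert z B)"
  have "y \<notin> B" "z \<notin> B" "finite B"
    using B(2) D(1) finD finite_subset by auto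
  then have "card S = r"
    using B(3) yz(3) r by (simp add: S_def)
  moreover have "S \<subseteq> {1..n}"
    using B(2) D(1) yz by (auto simp: S_def)
  ultimately obtain v where v: "v \<in> S" "inj_on (f v) {e. e \<subseteq> S \<and> card e = 2}"
    using good_colorings_complete_graphD[OF good] by blast
  have in_S: "d \<subseteq> S" "card d = 2" if "d \<in> {e, e', e''}" for d
    using that B(1) e by (auto simp: S_def E_def)
  \<comment> \<open>The repeated colours are on \<open>e\<close> and \<open>e'\<close> for
    \<open>y\<close>, on \<open>e\<close> and \<open>e''\<close> for \<open>z\<close>, and on the
    edges to \<open>y\<close> and \<open>z\<close> for a vertex of \<open>B\<close>.\<close>
  consider "v = y" | "v = z" | "v \<in> B"
    using v(1) by (auto simp: S_def)
  then show False
  proof cases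
    case 1
    then show False
      using inj_onD[OF v(2), of e' e] ey in_S by auto
  next
    case 2
    then show False
      using inj_onD[OF v(2), of e'' e] ez in_S by auto
  next
    case 3
    then have "f v {v, y} = f v {v, z}" "v \<noteq> y" "v \<noteq> z"
      using B(2) D by auto
    moreover from this have "{v, y} = {v, z}"
      using inj_onD[OF v(2), of "{v, y}" "{v, z}"] v(1) by (auto simp: S_def)
    ultimately show False
      using yz(3) by (auto simp: doubleton_eq_iff)
  qed
qed

text \<open>Here \<open>m\<close> is the size of \<open>D\<close> for a popular pair. If
  \<open>m < r - 2\<close>, then \<open>D\<close> is too small to complete a clique, but as
  \<open>r\<close> is fixed the first inequality already makes \<open>k\<close> at least linear in
  \<open>n\<close>.\<close>

lemma good_colorings_complete_graph_bound:
  assumes good: "good_colorings n (complete_graph r) k f" and "r \<ge> 8" "n \<ge> 2"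
  obtains m where "n - 1 \<le> k * (m + 1)" "m < r - 2 \<or> m choose 2 \<le> 2 * k"
proof -
  have "f v \<in> {e. e \<subseteq> {1..n} \<and> card e = 2} \<rightarrow> {1..k}" if "v \<in> {1..n}" for v
    using good that by (auto simp: good_colorings_def complete_graph_def)
  with \<open>n \<ge> 2\<close> obtain y z where yz: "y \<in> {1..n}" "z \<in> {1..n}" "y \<noteq> z"
    and le: "n - 1 \<le> k * (card {v \<in> {1..n} - {y, z}. f v {v, y} = f v {v, z}} + 1)"
    using exists_popular_pair by blast
  let ?D = "{v \<in> {1..n} - {y, z}. f v {v, y} = f v {v, z}}"
  have "card ?D choose 2 \<le> 2 * k" if "r - 2 \<le> card ?D"
    using good_colorings_popular_pair_bound[OF good \<open>r \<ge> 8\<close> yz _ _ that] by blast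
  then show thesis
    using that[OF le] by linarith
qed

theorem theorem2:
  fixes r :: nat
  assumes "r \<ge> 8"
  shows "(\<lambda>n. real (C n (complete_graph r))) \<in> \<Omega>(\<lambda>n. real n powr (2 / 3))"
proof (rule landau_omega.bigI)
  \<comment> \<open>Assuming \<open>k < a\<^sup>2 / 8\<close> with
    \<open>a = real n powr (1 / 3)\<close>, the second condition will exclude
    \<open>m < r - 2\<close> and the third \<open>m \<le> 2 * a\<close>.\<close>
  have "\<forall>\<^sub>F n in sequentially. n \<ge> 2 \<and> real r * real n powr (2 / 3) < real n - 1 \<and>
      (2 * real n powr (1 / 3) + 1) * (real n powr (2 / 3) / 8) < real n - 1 \<and>
      1 \<le> real n powr (1 / 3)"
    by (intro eventually_conj eventually_ge_at_top) real_asymp+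
  then show "\<forall>\<^sub>F n in sequentially.
      norm (real (C n (complete_graph r))) \<ge> 1 / 8 * norm (real n powr (2 / 3))"
  proof eventually_elim
    case (elim n)
    define k where "k = C n (complete_graph r)"
    define a where "a = real n powr (1 / 3)"
    have a2: "real n powr (2 / 3) = a\<^sup>2"
      by (simp add: a_def powr_powr flip: powr_numeral)
    have "verts (complete_graph r) \<noteq> {}"
      using assms by (simp add: complete_graph_def)
    then obtain f where "good_colorings n (complete_graph r) k f"
      unfolding k_def using good_colorings_C[of "complete_graph r" n] by metis
    then obtain m where m: "n - 1 \<le> k * (m + 1)" "m < r - 2 \<or> m choose 2 \<le> 2 * k"
      using good_colorings_complete_graph_bound assms elim by blast
    have "real (n - 1) \<le> real (k * (m + 1))"
      using m(1) by (simp only: of_nat_le_iff)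
    then have m1: "real n - 1 \<le> real k * (real m + 1)"
      using elim by (simp add: of_nat_diff algebra_simps)
    have "a\<^sup>2 / 8 \<le> real k"
    proof (rule ccontr)
      assume "\<not> ?thesis"
      then have k: "real k < a\<^sup>2 / 8" by simp
      have "real k * (real m + 1) < a\<^sup>2 / 8 * (real m + 1)"
        using k by (intro mult_strict_right_mono) auto
      with m1 have lt: "real n - 1 < (real m + 1) * (a\<^sup>2 / 8)"
        by (simp only: mult.commute[of "real m + 1"])
      have "\<not> real m \<le> 2 * a"
      proof
        assume "real m \<le> 2 * a"
        then have "(real m + 1) * (a\<^sup>2 / 8) \<le> (2 * a + 1) * (a\<^sup>2 / 8)"
          by (intro mult_right_mono) auto
        with lt elim show False
          by (simp add: a2 flip: a_def)
      qed
      then have ma: "real m > 2 * a" by simp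
      have "\<not> m < r - 2"
      proof
        assume "m < r - 2"
        then have "(real m + 1) * (a\<^sup>2 / 8) \<le> real r * a\<^sup>2"
          by (intro mult_mono) auto
        with lt elim show False
          by (simp add: a2)
      qed
      then have "m choose 2 \<le> 2 * k" using m(2) by simp
      \<comment> \<open>The binomial coefficient is a rounded-down half, so only
        \<open>4 * k + 1\<close> comes out at first; parity removes the 1.\<close>
      then have "m * (m - 1) \<le> 4 * k + 1"
        by (simp add: choose_two)
      moreover have "even (m * (m - 1))"
        by (cases m) auto
      ultimately have "m * (m - 1) \<le> 4 * k"
        by presburger
      moreover have "m \<ge> 1"
        using ma elim by (simp flip: a_def)
      ultimately have "real m * (real m - 1) \<le> 4 * real k"
        by (metis of_nat_1 of_nat_diff of_nat_le_iff of_nat_mult of_nat_numeral)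
      \<comment> \<open>From \<open>m > 2 * a\<close> and \<open>a \<ge> 1\<close> follows
        \<open>m - 1 \<ge> a\<close>. The product is then at least \<open>2 * a\<^sup>2\<close>,
        while \<open>4 * k\<close> stays below \<open>a\<^sup>2 / 2\<close>.\<close>
      moreover have "2 * a * a \<le> real m * (real m - 1)"
        using ma elim by (intro mult_mono) (auto simp flip: a_def)
      ultimately have "2 * a\<^sup>2 \<le> 4 * (a\<^sup>2 / 8)"
        using k by (simp add: power2_eq_square)
      moreover have "a\<^sup>2 > 0"
        using elim by (simp flip: a_def)
      ultimately show False by simp
    qed
    then show ?case
      by (simp add: a2 k_def)
  qed
qed simp

end
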